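(* Let $e=2e'+1\ge3$ be an odd integer, and let $P_e=\det(\mathbb Y_e)\in\mathbb Z[y_1,\dots,y_e]$ be the $e$-th cascade polynomial. Let $\Gamma$ be the cycle with vertices $\{1,\ldots,e\}$ and edges $\{(i,i+e') : i=1,\ldots,e\}$ (indices modulo $e$). Let $\mathcal S\subseteq\{1,\ldots,e\}$. The subgraph of $\Gamma$ induced by $\mathcal C=\{1,\ldots,e\}\setminus\mathcal S$ is a disjoint union of connected components, of sizes (numbers of vertices) $i_1,\ldots,i_r$. Then the monomial $\mathbf y_{\mathcal S}=\prod_{i\in\mathcal S}y_i$ appears in $P_e$ with coefficient $$e'-\sum_{j=1}^r\left\lceil\frac{i_j}{2}\right\rceil,$$ and this coefficient is non-negative if $\mathcal S$ is not empty. In particular, $P_e$ has total degree $e$ and leading term $e'\cdot y_1\cdots y_e$.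
   Context: For $e=2e'+1$ odd and variables $y_1,\dots,y_e$, the $e$-th cascade matrix $\mathbb Y_e$ is the $e\times e$ matrix with $(i,j)$ entry equal to $-1$ if $i=j$; $0$ if $i<j\le i+e'$, where indices are read cyclically modulo $e$ (i.e. if $0<(j-i \bmod e)\le e'$); and $y_j$ otherwise. All monomials of $P_e=\det(\mathbb Y_e)$ are squarefree, i.e. of the form $\mathbf y_{\mathcal S}$. *)

theory Defs
  imports
    Complex_Main
    "HOL-Library.Poly_Mapping"
    "HOL-Number_Theory.Cong"
    "Jordan_Normal_Form.Determinant"
    "Graph_Theory.Digraph_Component"
begin

text \<open>
  Polynomials with integer coefficients in variables indexed by natural numbers, as
  finitely supported functions from exponent vectors to coefficients; ring operations
  are those of \<^theory>\<open>HOL-Library.Poly_Mapping\<close>. The coefficient of the monomial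
  with exponent vector \<open>m\<close> in \<open>p\<close> is \<open>lookup p m\<close>.
\<close>

type_synonym int_mpoly = "(nat \<Rightarrow>\<^sub>0 nat) \<Rightarrow>\<^sub>0 int"

definition yvar :: "nat \<Rightarrow> int_mpoly" where
  "yvar j = Poly_Mapping.single (Poly_Mapping.single j 1) 1"

definition squarefree_exponent :: "nat set \<Rightarrow> nat \<Rightarrow>\<^sub>0 nat" where
  "squarefree_exponent S = (\<Sum>i\<in>S. Poly_Mapping.single i 1)"

definition monomial_degree :: "(nat \<Rightarrow>\<^sub>0 nat) \<Rightarrow> nat" where
  "monomial_degree m = (\<Sum>i\<in>Poly_Mapping.keys m. Poly_Mapping.lookup m i)"

text \<open>By convention the zero polynomial has total degree 0.\<close>

definition total_degree :: "int_mpoly \<Rightarrow> nat" where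
  "total_degree p = Max (insert 0 (monomial_degree ` Poly_Mapping.keys p))"

text \<open>
  The sum of all terms of maximal total degree. If it consists of a single term, that
  term is the leading term of \<open>p\<close> for every monomial order refining the total degree.
\<close>

definition leading_form :: "int_mpoly \<Rightarrow> int_mpoly" where
  "leading_form p =
    (\<Sum>m\<in>{m \<in> Poly_Mapping.keys p. monomial_degree m = total_degree p}.
       Poly_Mapping.single m (Poly_Mapping.lookup p m))"

text \<open>
  Below, \<open>e = 2 * e' + 1\<close> is odd, so \<open>e' = e div 2\<close>. The entries are given for indices
  in \<open>{1..e}\<close>; the shift by one in the matrix is due to \<^typ>\<open>'a mat\<close> being indexed from 0.
\<close>

definition cascade_entry :: "nat \<Rightarrow> nat \<Rightarrow> nat \<Rightarrow> int_mpoly" where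
  "cascade_entry e i j =
    (if i = j then - 1
     else if 0 < (int j - int i) mod int e \<and> (int j - int i) mod int e \<le> int (e div 2) then 0
     else yvar j)"

definition cascade_matrix :: "nat \<Rightarrow> int_mpoly mat" where
  "cascade_matrix e = mat e e (\<lambda>(i, j). cascade_entry e (i + 1) (j + 1))"

definition cascade_poly :: "nat \<Rightarrow> int_mpoly" where
  "cascade_poly e = det (cascade_matrix e)"

text \<open>An undirected graph is represented as a digraph with symmetric arc set.\<close>

definition cascade_graph :: "nat \<Rightarrow> (nat, nat \<times> nat) pre_digraph" where
  "cascade_graph e = with_proj
    \<lparr> pverts = {1..e},
      parcs = {(i, j). i \<in> {1..e} \<and> j \<in> {1..e} \<and>
                 ([j = i + e div 2] (mod e) \<or> [i = j + e div 2] (mod e))} \<rparr>"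

definition connected_components :: "('a, 'b) pre_digraph \<Rightarrow> ('a, 'b) pre_digraph set" where
  "connected_components G = {H. pre_digraph.max_subgraph G Digraph_Component.connected H}"

end

theory Submission
  imports Defs
begin

text \<open>
  Number the vertices along the cycle \<open>\<Gamma>\<close>, i.e. let \<open>i + e'\<close> follow \<open>i\<close>. In this order the
  off-diagonal entry \<open>(k, l)\<close> of the cascade matrix \<open>B\<close> is \<open>y\<^sub>l\<close> or \<open>0\<close> depending on the parity of
  \<open>k - l\<close>, so with the cyclic shift \<open>Q\<close>, \<open>D = diag(y)\<close> and \<open>J\<close> the all-ones matrix,
  \<open>(I + Q) B = J D - (I + Q (I + D))\<close>. The matrix \<open>I + Q (I + D)\<close> is a weighted cycle of
  determinant \<open>1 + \<Prod>(1 + y\<^sub>i)\<close>, \<open>J D\<close> has rank one, and \<open>det (I + Q) = 2\<close>, which gives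
  \<open>2 P\<^sub>e = - 1 - \<Prod>(1 + y\<^sub>i) + (\<Sum>k<e. y\<^sub>k (\<Sum>t<e. (-1)\<^sup>t (1 + y\<^sub>k\<^sub>+\<^sub>1) \<cdots> (1 + y\<^sub>k\<^sub>+\<^sub>t)))\<close>.
  For \<open>S \<noteq> {}\<close>, the alternating sum attached to \<open>k \<in> S\<close> contributes \<open>1\<close> or \<open>0\<close> to the coefficient of
  \<open>y\<^sub>S\<close> according as the block of the complement of \<open>S\<close> immediately preceding \<open>k\<close> has even or odd
  size. These blocks are the components of the induced subgraph, and together with \<open>S\<close> they have
  \<open>2 e' + 1\<close> elements.
\<close>

section \<open>The determinant of the renumbered matrix\<close>

text \<open>The sign of \<open>p\<close> enters once for the rows and once, through the transpose,
  for the columns; its square is 1.\<close>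

lemma det_permute_rows_cols:
  assumes A: "A \<in> carrier_mat n n" and p: "p permutes {0..<n}"
  shows "det (mat n n (\<lambda>(i, j). A $$ (p i, p j))) = det A"
proof -
  let ?R = "mat n n (\<lambda>(i, j). A $$ (p i, j))"
  have pn: "p i < n" if "i < n" for i
    using permutes_in_image[OF p, of i] that by auto
  have "mat n n (\<lambda>(i, j). A $$ (p i, p j)) =
      transpose_mat (mat n n (\<lambda>(i, j). transpose_mat ?R $$ (p i, j)))"
    by (rule eq_matI) (auto simp: pn)
  then have "det (mat n n (\<lambda>(i, j). A $$ (p i, p j))) =
      det (mat n n (\<lambda>(i, j). transpose_mat ?R $$ (p i, j)))"
    by (simp add: det_transpose[of _ n])
  also have "\<dots> = signof p * det (transpose_mat ?R)"
    by (rule det_permute_rows[OF _ p]) simp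
  also have "det (transpose_mat ?R) = det ?R"
    by (rule det_transpose[of _ n]) simp
  also have "det ?R = signof p * det A"
    by (rule det_permute_rows[OF A p])
  also have "signof p * (signof p * det A) = det A"
    by (simp add: sign_def)
  finally show ?thesis .
qed

text \<open>A division-free matrix determinant lemma: \<open>x\<close> stands for \<open>d\<close>
  times the inverse of \<open>M\<close> applied to \<open>u\<close>. The bordered matrix
  \<open>?K\<close> is made block triangular by column operations in two ways, and the two values of
  its determinant are compared.\<close>

lemma det_rank_one_update:
  fixes M :: "'a :: idom mat"
  assumes M: "M \<in> carrier_mat n n" and u: "u \<in> carrier_mat n 1"
    and y: "y \<in> carrier_mat 1 n" and x: "x \<in> carrier_mat n 1"
    and Mx: "M * x = d \<cdot>\<^sub>m u"
  shows "det (M - u * y) * d = det M * (d - (y * x) $$ (0, 0))"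
proof -
  let ?K = "four_block_mat M u y (1\<^sub>m 1)"
  \<comment> \<open>\<open>?L\<close> clears the row \<open>y\<close> and leaves the Schur
    complement \<open>M - u * y\<close>. \<open>?R\<close> clears the column \<open>u\<close> by
    means of \<open>Mx\<close>; its determinant \<open>d\<close> is the extra factor on the
    left.\<close>
  let ?L = "four_block_mat (1\<^sub>m n) (0\<^sub>m n 1) (- y) (1\<^sub>m 1)"
  let ?R = "four_block_mat (1\<^sub>m n) (- x) (0\<^sub>m 1 n) (d \<cdot>\<^sub>m 1\<^sub>m 1)"
  have K: "?K \<in> carrier_mat (n + 1) (n + 1)"
    by (rule four_block_carrier_mat[OF M]) simp
  have "?K * ?L = four_block_mat (M * 1\<^sub>m n + u * - y) (M * 0\<^sub>m n 1 + u * 1\<^sub>m 1)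
      (y * 1\<^sub>m n + 1\<^sub>m 1 * - y) (y * 0\<^sub>m n 1 + 1\<^sub>m 1 * 1\<^sub>m 1)"
    by (rule mult_four_block_mat) (use M u y in auto)
  also have "\<dots> = four_block_mat (M - u * y) u (0\<^sub>m 1 n) (1\<^sub>m 1)"
  proof -
    have "M * 1\<^sub>m n + u * - y = M - u * y"
      using M u y by (intro eq_matI) auto
    moreover have "M * 0\<^sub>m n 1 + u * 1\<^sub>m 1 = u"
      using M u by (auto simp: right_mult_zero_mat[OF M])
    moreover have "y * 1\<^sub>m n + 1\<^sub>m 1 * - y = 0\<^sub>m 1 n"
      using y by (auto intro!: eq_matI)
    moreover have "y * 0\<^sub>m n 1 + 1\<^sub>m 1 * 1\<^sub>m 1 = (1\<^sub>m 1 :: 'a mat)"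
      using y by (auto simp: right_mult_zero_mat[OF y])
    ultimately show ?thesis by simp
  qed
  finally have KL: "?K * ?L = four_block_mat (M - u * y) u (0\<^sub>m 1 n) (1\<^sub>m 1)" .
  have "det ?K * det ?L = det (?K * ?L)"
    by (rule det_mult[symmetric, OF K]) (rule four_block_carrier_mat, auto)
  moreover have "det ?L = 1"
    using y by (subst det_four_block_mat_upper_right_zero[of _ n _ 1]) auto
  moreover have "det (?K * ?L) = det (M - u * y)"
    unfolding KL using M u y
    by (subst det_four_block_mat_lower_left_zero[of _ n _ 1]) (auto simp: minus_carrier_mat)
  ultimately have 1: "det ?K = det (M - u * y)" by simp
  have "?K * ?R = four_block_mat (M * 1\<^sub>m n + u * 0\<^sub>m 1 n) (M * - x + u * (d \<cdot>\<^sub>m 1\<^sub>m 1))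
      (y * 1\<^sub>m n + 1\<^sub>m 1 * 0\<^sub>m 1 n) (y * - x + 1\<^sub>m 1 * (d \<cdot>\<^sub>m 1\<^sub>m 1))"
    by (rule mult_four_block_mat) (use M u x y in auto)
  also have "\<dots> = four_block_mat M (0\<^sub>m n 1) y (mat 1 1 (\<lambda>_. d - (y * x) $$ (0, 0)))"
  proof -
    have "M * 1\<^sub>m n + u * 0\<^sub>m 1 n = M"
      using M u by (auto simp: right_mult_zero_mat[OF u])
    moreover have "M * - x + u * (d \<cdot>\<^sub>m 1\<^sub>m 1) = 0\<^sub>m n 1"
    proof -
      have "M * - x = - (d \<cdot>\<^sub>m u)"
        using M x Mx by auto
      moreover have "u * (d \<cdot>\<^sub>m 1\<^sub>m 1) = d \<cdot>\<^sub>m u"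
        using u by (simp add: mult_smult_distrib[of _ n 1 _ 1])
      ultimately show ?thesis using u by (auto intro!: eq_matI)
    qed
    moreover have "y * 1\<^sub>m n + 1\<^sub>m 1 * 0\<^sub>m 1 n = y"
      using y by auto
    moreover have "y * - x + 1\<^sub>m 1 * (d \<cdot>\<^sub>m 1\<^sub>m 1) = mat 1 1 (\<lambda>_. d - (y * x) $$ (0, 0))"
      using x y by (intro eq_matI) auto
    ultimately show ?thesis by simp
  qed
  finally have KR: "?K * ?R = four_block_mat M (0\<^sub>m n 1) y (mat 1 1 (\<lambda>_. d - (y * x) $$ (0, 0)))" .
  have "det ?K * det ?R = det (?K * ?R)"
    by (rule det_mult[symmetric, OF K]) (rule four_block_carrier_mat, auto)
  moreover have "det ?R = d"
    using x by (subst det_four_block_mat_lower_left_zero[of _ n _ 1]) (auto simp: det_single)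
  moreover have "det (?K * ?R) = det M * (d - (y * x) $$ (0, 0))"
    unfolding KR using M y
    by (subst det_four_block_mat_upper_right_zero[of _ n _ 1]) (auto simp: det_single)
  ultimately show ?thesis using 1 by simp
qed

section \<open>Weighted directed cycles and the renumbered cascade matrix\<close>

definition cyclic_mat :: "nat \<Rightarrow> (nat \<Rightarrow> 'a) \<Rightarrow> 'a :: comm_ring_1 mat" where
  "cyclic_mat n a = mat n n (\<lambda>(k, l). of_bool (k = l) + of_bool (l = Suc k mod n) * a l)"

lemma cyclic_mat_carrier [simp]: "cyclic_mat n a \<in> carrier_mat n n"
  by (simp add: cyclic_mat_def)

lemma cyclic_mat_dim [simp]: "dim_row (cyclic_mat n a) = n" "dim_col (cyclic_mat n a) = n"
  by (simp_all add: cyclic_mat_def)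

lemma cyclic_mat_mult_index:
  assumes X: "X \<in> carrier_mat n m" and "k < n" "j < m"
  shows "(cyclic_mat n a * X) $$ (k, j) = X $$ (k, j) + a (Suc k mod n) * X $$ (Suc k mod n, j)"
proof -
  have "(cyclic_mat n a * X) $$ (k, j) =
      (\<Sum>i\<in>{0..<n}. (of_bool (k = i) + of_bool (i = Suc k mod n) * a i) * X $$ (i, j))"
    using assms by (auto simp: cyclic_mat_def scalar_prod_def)
  also have "\<dots> = (\<Sum>i\<in>{0..<n}. if k = i then X $$ (i, j) else 0) +
      (\<Sum>i\<in>{0..<n}. if i = Suc k mod n then a i * X $$ (i, j) else 0)"
    unfolding sum.distrib[symmetric] by (rule sum.cong) (auto simp: algebra_simps)
  finally show ?thesis using assms by simp
qed

text \<open>Left multiplication by a unit triangular \<open>V\<close> that alters only the last row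
  makes the matrix upper triangular with a single diagonal entry other than 1.\<close>

lemma det_cyclic_mat:
  fixes a :: "nat \<Rightarrow> 'a :: comm_ring_1"
  assumes "n \<ge> 2"
  shows "det (cyclic_mat n a) = 1 - (- 1) ^ n * (\<Prod>i<n. a i)"
proof -
  obtain m where n: "n = Suc m" "m \<ge> 1" using assms by (cases n) auto
  \<comment> \<open>These coefficients solve \<open>v 0 + a 0 = 0\<close> and
    \<open>v l + v (l - 1) * a l = 0\<close> for \<open>0 < l < m\<close>, with
    \<open>v m = 1\<close>: the conditions that clear the last row left of the diagonal.\<close>
  define v where "v l = (if l = m then 1 else (- 1) ^ Suc l * (\<Prod>i\<le>l. a i))" for l
  define V where "V = mat n n (\<lambda>(k, l). if k = m then v l else of_bool (k = l))"
  define W where "W = V * cyclic_mat n a"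
  have carr: "V \<in> carrier_mat n n" "W \<in> carrier_mat n n"
    unfolding W_def by (auto simp: V_def intro!: mult_carrier_mat[of _ n n])
  have one: "prod_list (map (\<lambda>_. 1 :: 'a) xs) = 1" for xs :: "nat list"
    by (induction xs) auto
  have detV: "det V = 1"
  proof -
    have "det V = prod_list (diag_mat V)"
      by (rule det_lower_triangular[of n]) (auto simp: V_def n v_def)
    also have "diag_mat V = map (\<lambda>_. 1) [0..<n]"
      by (auto simp: diag_mat_def V_def v_def)
    finally show ?thesis by (simp add: one)
  qed
  have top: "W $$ (k, l) = of_bool (k = l) + of_bool (l = Suc k) * a l" if "k < m" "l < n" for k l
  proof -
    have "W $$ (k, l) = (\<Sum>i\<in>{0..<n}. of_bool (k = i) * cyclic_mat n a $$ (i, l))"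
      using that n by (auto simp: W_def V_def scalar_prod_def cyclic_mat_def)
    also have "\<dots> = (\<Sum>i\<in>{0..<n}. if k = i then cyclic_mat n a $$ (i, l) else 0)"
      by (rule sum.cong) auto
    finally show ?thesis using that n by (auto simp: cyclic_mat_def)
  qed
  have bot: "W $$ (m, l) = v l + v (if l = 0 then m else l - 1) * a l" if "l < n" for l
  proof -
    \<comment> \<open>Off the diagonal, column \<open>l\<close> is supported in the cyclically
      preceding row, which is row \<open>m\<close> for \<open>l = 0\<close>.\<close>
    have eq: "l = Suc i mod n \<longleftrightarrow> i = (if l = 0 then m else l - 1)" if "i < n" for i
      using that \<open>l < n\<close> n by (cases "i = m") auto
    have "W $$ (m, l) = (\<Sum>i\<in>{0..<n}. v i * (of_bool (i = l) + of_bool (l = Suc i mod n) * a l))"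
      using that n by (auto simp: W_def V_def scalar_prod_def cyclic_mat_def)
    also have "\<dots> = (\<Sum>i\<in>{0..<n}. if i = l then v i else 0) +
        (\<Sum>i\<in>{0..<n}. if i = (if l = 0 then m else l - 1) then v i * a l else 0)"
      unfolding sum.distrib[symmetric] by (rule sum.cong) (use eq in \<open>auto simp: algebra_simps\<close>)
    also have "\<dots> = v l + v (if l = 0 then m else l - 1) * a l"
      using that n by auto
    finally show ?thesis .
  qed
  have bot0: "W $$ (m, l) = 0" if "l < m" for l
    using that n by (cases l) (auto simp: bot v_def)
  have botm: "W $$ (m, m) = 1 - (- 1) ^ n * (\<Prod>i<n. a i)"
  proof -
    obtain r where r: "m = Suc r" using n by (cases m) auto
    have "W $$ (m, m) = v m + v r * a m"
      using bot[of m] n r by simp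
    then show ?thesis by (simp add: n v_def r lessThan_Suc_atMost algebra_simps)
  qed
  have "det W = prod_list (diag_mat W)"
    using carr top bot0 n by (intro det_upper_triangular[of _ n] upper_triangularI) (auto simp: less_Suc_eq)
  also have "diag_mat W = map (\<lambda>_. 1) [0..<m] @ [W $$ (m, m)]"
    using carr n top by (auto simp: diag_mat_def)
  finally have "det W = 1 - (- 1) ^ n * (\<Prod>i<n. a i)"
    by (simp add: botm one)
  then show ?thesis
    unfolding W_def by (simp add: det_mult[OF carr(1) cyclic_mat_carrier] detV)
qed

text \<open>The cascade matrix after renumbering the indices along the cycle; \<open>z l\<close> is the
  variable attached to the vertex in position \<open>l\<close>.\<close>

definition cascade_cycle_mat :: "nat \<Rightarrow> (nat \<Rightarrow> 'a) \<Rightarrow> 'a :: comm_ring_1 mat" where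
  "cascade_cycle_mat n z =
    mat n n (\<lambda>(k, l). if k = l then - 1 else if odd (k + l) \<longleftrightarrow> l < k then z l else 0)"

text \<open>The rank-one identity is applied with \<open>d = det M\<close>, so \<open>d\<close>
  occurs on both sides and \<open>nz\<close> allows it to be cancelled. The factor 2 is the
  determinant of \<open>I + Q\<close>.\<close>

lemma det_cascade_cycle_mat:
  fixes z :: "nat \<Rightarrow> 'a :: idom"
  assumes odd: "odd n" and n: "n \<ge> 2" and per: "\<And>k. z (k + n) = z k"
    and nz: "1 + (\<Prod>i<n. 1 + z i) \<noteq> 0"
  shows "2 * det (cascade_cycle_mat n z) =
    (\<Sum>k<n. z k * (\<Sum>t<n. (- 1) ^ t * (\<Prod>s<t. 1 + z (k + Suc s)))) - (1 + (\<Prod>i<n. 1 + z i))"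
proof -
  define d where "d = 1 + (\<Prod>i<n. 1 + z i)"
  \<comment> \<open>Solving \<open>M * X = u\<close> by unrolling once around the cycle gives this
    alternating sum divided by \<open>d\<close>; keeping only the numerator avoids division.\<close>
  define x where "x k = (\<Sum>t<n. (- 1) ^ t * (\<Prod>s<t. 1 + z (k + Suc s)))" for k
  define B where "B = cascade_cycle_mat n z"
  define M where "M = cyclic_mat n (\<lambda>l. 1 + z l)"
  define u y X where "u = mat n 1 (\<lambda>_. 1 :: 'a)" and "y = mat 1 n (\<lambda>(_, l). z l)"
    and "X = mat n 1 (\<lambda>(k, _). x k)"
  have mod_z: "z (k mod n) = z k" for k
  proof -
    have "z (r + n * q) = z r" for r q
    proof (induction q)
      case (Suc q)
      then show ?case using per[of "r + n * q"] by (simp add: ac_simps)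
    qed simp
    from this[of "k mod n" "k div n"] show ?thesis by simp
  qed
  have mod_x: "x (k mod n) = x k" for k
  proof -
    have "z (k mod n + Suc s) = z (k + Suc s)" for s
      by (metis mod_z mod_add_left_eq)
    then show ?thesis by (simp add: x_def)
  qed
  have shift_prod: "(\<Prod>s<n. 1 + z (k + s)) = (\<Prod>i<n. 1 + z i)" for k
  proof (induction k)
    case (Suc k)
    obtain m where m: "n = Suc m" using n by (cases n) auto
    have "(\<Prod>s<n. 1 + z (Suc k + s)) = (\<Prod>s<m. 1 + z (Suc k + s)) * (1 + z (k + n))"
      by (simp add: m)
    also have "\<dots> = (\<Prod>s<n. 1 + z (k + s))"
      unfolding m prod.lessThan_Suc_shift using per[of k] m by (simp add: mult.commute)
    finally show ?case using Suc by simp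
  qed simp
  have x_rec: "x k + (1 + z (Suc k)) * x (Suc k) = d" for k
  proof -
    let ?q = "\<lambda>t. (- 1) ^ t * (\<Prod>s<t. 1 + z (k + Suc s))"
    \<comment> \<open>The new factor completes each product at its front, so term \<open>t\<close>
      becomes minus term \<open>t + 1\<close> of \<open>x k\<close>, and the sum telescopes.\<close>
    have "(1 + z (Suc k)) * x (Suc k) = (\<Sum>t<n. - ?q (Suc t))"
      unfolding x_def sum_distrib_left prod.lessThan_Suc_shift
      by (rule sum.cong) (auto simp: algebra_simps)
    then have "x k + (1 + z (Suc k)) * x (Suc k) = (\<Sum>t<n. ?q t - ?q (Suc t))"
      by (simp only: x_def sum.distrib[symmetric] add_uminus_conv_diff)
    also have "\<dots> = ?q 0 - ?q n"
      by (rule sum_lessThan_telescope')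
    also have "\<dots> = d"
      using odd shift_prod[of "Suc k"] by (simp add: d_def)
    finally show ?thesis .
  qed
  have carr: "B \<in> carrier_mat n n" "M \<in> carrier_mat n n" "u \<in> carrier_mat n 1"
    "y \<in> carrier_mat 1 n" "X \<in> carrier_mat n 1"
    by (simp_all add: B_def cascade_cycle_mat_def M_def u_def y_def X_def)
  have detM: "det M = d"
    using det_cyclic_mat[OF n, of "\<lambda>l. 1 + z l"] odd by (simp add: M_def d_def)
  have MX: "M * X = d \<cdot>\<^sub>m u"
  proof (rule eq_matI)
    fix i j assume "i < dim_row (d \<cdot>\<^sub>m u)" "j < dim_col (d \<cdot>\<^sub>m u)"
    then have ij: "i < n" "j = 0" by (auto simp: u_def)
    have "Suc i mod n < n" using n by simp
    then show "(M * X) $$ (i, j) = (d \<cdot>\<^sub>m u) $$ (i, j)"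
      unfolding M_def cyclic_mat_mult_index[OF carr(5) ij(1), of j, unfolded ij(2), simplified] ij(2)
      using ij x_rec[of i] by (simp add: u_def X_def mod_z mod_x)
  qed (use carr in auto)
  have "det (M - u * y) * d = det M * (d - (y * X) $$ (0, 0))"
    by (rule det_rank_one_update[OF carr(2-5) MX])
  then have detN: "det (M - u * y) = d - (y * X) $$ (0, 0)"
    using detM nz by (simp add: d_def)
  \<comment> \<open>Consecutive rows have complementary parity patterns. Adding to each row its
    cyclic successor therefore puts \<open>z l\<close> everywhere in column \<open>l\<close>, up to
    corrections on the diagonal and the shifted diagonal.\<close>
  have QB: "cyclic_mat n (\<lambda>_. 1) * B = (- 1) \<cdot>\<^sub>m (M - u * y)"
  proof (rule eq_matI)
    fix k l assume "k < dim_row ((- 1) \<cdot>\<^sub>m (M - u * y))" "l < dim_col ((- 1) \<cdot>\<^sub>m (M - u * y))"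
    then have kl: "k < n" "l < n" using carr by auto
    have "Suc k mod n < n" using n by simp
    then have "(cyclic_mat n (\<lambda>_. 1) * B) $$ (k, l) =
       (if k = l then - 1 else if odd (k + l) \<longleftrightarrow> l < k then z l else 0) +
       (if Suc k mod n = l then - 1 else if odd (Suc k mod n + l) \<longleftrightarrow> l < Suc k mod n then z l else 0)"
      using kl by (simp add: cyclic_mat_mult_index[OF carr(1)]) (simp add: B_def cascade_cycle_mat_def)
    also have "\<dots> = z l - of_bool (k = l) - of_bool (l = Suc k mod n) * (1 + z l)"
    proof (cases "Suc k = n")
      case True
      \<comment> \<open>For odd \<open>n\<close> the patterns of rows \<open>n - 1\<close> and 0 are
        complementary too, so the wrap-around is no exception.\<close>
      then have "even k" using odd by auto
      with True show ?thesis using kl n by auto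
    next
      case False
      then have "Suc k mod n = Suc k" using kl by auto
      then show ?thesis by auto
    qed
    also have "\<dots> = ((- 1) \<cdot>\<^sub>m (M - u * y)) $$ (k, l)"
      using kl carr by (simp add: M_def cyclic_mat_def u_def y_def scalar_prod_def)
    finally show "(cyclic_mat n (\<lambda>_. 1) * B) $$ (k, l) = ((- 1) \<cdot>\<^sub>m (M - u * y)) $$ (k, l)" .
  qed (use carr in auto)
  have "2 * det B = det (cyclic_mat n (\<lambda>_. 1) * B)"
    using odd by (simp add: det_mult[OF cyclic_mat_carrier carr(1)] det_cyclic_mat[OF n])
  also have "\<dots> = - det (M - u * y)"
    unfolding QB using carr odd by simp
  finally have "2 * det B = (y * X) $$ (0, 0) - d"
    unfolding detN by simp
  also have "(y * X) $$ (0, 0) = (\<Sum>k<n. z k * x k)"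
    by (simp add: y_def X_def scalar_prod_def lessThan_atLeast0)
  finally show ?thesis
    by (simp add: B_def x_def d_def)
qed

section \<open>Numbering the vertices along the cycle, with vertex 1 in position 0\<close>

definition cycle_vertex :: "nat \<Rightarrow> nat \<Rightarrow> nat" where
  "cycle_vertex e k = k * (e div 2) mod e + 1"

lemma coprime_div_2:
  fixes e :: nat
  assumes "odd e"
  shows "coprime (e div 2) e"
proof -
  obtain m where "e = 2 * m + 1" using assms by (elim oddE)
  moreover from this have "coprime m e"
    by (intro coprimeI) (metis dvd_add_right_iff dvd_mult)
  ultimately show ?thesis by simp
qed

text \<open>Multiplication by \<open>e div 2\<close> is invertible modulo \<open>e\<close>, so a
  position modulo \<open>e\<close> is determined by its vertex.\<close>

lemma cycle_vertex_eq_iff: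
  assumes "odd e"
  shows "cycle_vertex e k = cycle_vertex e l \<longleftrightarrow> [k = l] (mod e)"
proof -
  have "cycle_vertex e k = cycle_vertex e l \<longleftrightarrow> [k * (e div 2) = l * (e div 2)] (mod e)"
    by (simp add: cycle_vertex_def cong_def)
  also have "\<dots> \<longleftrightarrow> [k = l] (mod e)"
    using coprime_div_2[OF assms] by (rule cong_mult_rcancel_nat)
  finally show ?thesis .
qed

lemma cycle_vertex_add [simp]: "cycle_vertex e (k + e) = cycle_vertex e k"
  by (simp add: cycle_vertex_def add_mult_distrib)

lemma inj_on_cycle_vertex:
  assumes "odd e"
  shows "inj_on (\<lambda>s. cycle_vertex e (k + s)) {..<e}"
  by (rule inj_onI) (auto simp: cycle_vertex_eq_iff[OF assms] cong_add_lcancel_nat cong_less_modulus_unique_nat)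

lemma cycle_vertex_image:
  assumes "odd e"
  shows "(\<lambda>s. cycle_vertex e (k + s)) ` {..<e} = {1..e}"
proof (rule card_subset_eq)
  have "e > 0" using assms by (cases e) auto
  then show "(\<lambda>s. cycle_vertex e (k + s)) ` {..<e} \<subseteq> {1..e}"
    by (auto simp: cycle_vertex_def less_eq_Suc_le[symmetric])
  show "card ((\<lambda>s. cycle_vertex e (k + s)) ` {..<e}) = card {1..e}"
    by (simp add: card_image[OF inj_on_cycle_vertex[OF assms]])
qed simp

text \<open>Modulo \<open>2 * m + 1\<close>, multiplication by \<open>m\<close> is division by -2:
  it sends \<open>2 * a\<close> to \<open>- a\<close> and \<open>2 * a + 1\<close> to
  \<open>m - a\<close>. The bound on \<open>\<delta>\<close> then shows which of these have their
  representative in the lower half.\<close>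

lemma half_residue_iff:
  fixes \<delta> m :: int
  assumes "\<bar>\<delta>\<bar> < 2 * m + 1" "\<delta> \<noteq> 0"
  shows "(\<delta> * m) mod (2 * m + 1) \<in> {1..m} \<longleftrightarrow> (odd \<delta> \<longleftrightarrow> \<delta> > 0)"
proof -
  define e where "e = 2 * m + 1"
  have res: "(\<delta> * m) mod e = r" if "\<delta> * m = q * e + r" "0 \<le> r" "r < e" for q r
    using that by simp
  obtain a where "\<delta> = 2 * a \<or> \<delta> = 2 * a + 1" by (metis evenE oddE)
  then show ?thesis
  proof
    assume \<delta>: "\<delta> = 2 * a"
    show ?thesis
    proof (cases "\<delta> > 0")
      case True
      have "(\<delta> * m) mod e = e - a"
        by (rule res[of "a - 1"]) (use \<delta> assms True in \<open>auto simp: e_def algebra_simps\<close>)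
      then show ?thesis using \<delta> assms True by (auto simp: e_def)
    next
      case False
      have "(\<delta> * m) mod e = - a"
        by (rule res[of a]) (use \<delta> assms False in \<open>auto simp: e_def algebra_simps\<close>)
      then show ?thesis using \<delta> assms False by (auto simp: e_def)
    qed
  next
    assume \<delta>: "\<delta> = 2 * a + 1"
    have "(\<delta> * m) mod e = m - a"
      by (rule res[of a]) (use \<delta> assms in \<open>auto simp: e_def algebra_simps\<close>)
    then show ?thesis using \<delta> assms by (auto simp: e_def)
  qed
qed

text \<open>The vertices in positions \<open>k\<close> and \<open>l\<close> differ by
  \<open>(l - k) * (e div 2)\<close> modulo \<open>e\<close>, so the cyclic interval condition of
  the cascade matrix becomes a condition on the parity and sign of \<open>l - k\<close>.\<close>

lemma cascade_entry_cycle_vertex: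
  assumes "odd e" "k < e" "l < e"
  shows "cascade_entry e (cycle_vertex e k) (cycle_vertex e l) =
    (if k = l then - 1 else if odd (k + l) \<longleftrightarrow> l < k then yvar (cycle_vertex e l) else 0)"
proof (cases "k = l")
  case False
  obtain m where e: "e = 2 * m + 1" using assms(1) by (elim oddE)
  have neq: "cycle_vertex e k \<noteq> cycle_vertex e l"
    using False assms by (auto simp: cycle_vertex_eq_iff dest: cong_less_modulus_unique_nat)
  have "(int (cycle_vertex e l) - int (cycle_vertex e k)) mod int e = ((int l - int k) * int m) mod (2 * int m + 1)"
    by (simp add: cycle_vertex_def e of_nat_mod mod_diff_eq left_diff_distrib)
       (metis add.commute mod_diff_eq)
  then have "0 < (int (cycle_vertex e l) - int (cycle_vertex e k)) mod int e \<and>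
      (int (cycle_vertex e l) - int (cycle_vertex e k)) mod int e \<le> int (e div 2) \<longleftrightarrow>
      ((int l - int k) * int m) mod (2 * int m + 1) \<in> {1..int m}"
    by (auto simp: e)
  also have "\<dots> \<longleftrightarrow> (odd (int l - int k) \<longleftrightarrow> int l - int k > 0)"
    by (rule half_residue_iff) (use False assms(2,3) e in auto)
  also have "\<dots> \<longleftrightarrow> \<not> (odd (k + l) \<longleftrightarrow> l < k)"
    using False by (cases "k < l") auto
  finally show ?thesis
    using False neq by (simp add: cascade_entry_def)
qed (simp add: cascade_entry_def)

lemma cascade_poly_eq_det_cycle:
  assumes "odd e"
  shows "cascade_poly e = det (cascade_cycle_mat e (\<lambda>k. yvar (cycle_vertex e k)))"
proof -
  \<comment> \<open>The numbering shifted to start at 0, extended by the identity because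
    \<open>permutes\<close> speaks about all naturals.\<close>
  define p where "p k = (if k < e then k * (e div 2) mod e else k)" for k
  have Suc_p: "p k + 1 = cycle_vertex e k" if "k < e" for k
    using that by (simp add: p_def cycle_vertex_def)
  have "p permutes {0..<e}"
  proof (rule bij_imp_permutes)
    have "inj_on p {0..<e}"
    proof (rule inj_onI)
      fix k l assume "k \<in> {0..<e}" "l \<in> {0..<e}" "p k = p l"
      then have "cycle_vertex e (0 + k) = cycle_vertex e (0 + l)" by (simp flip: Suc_p)
      then show "k = l"
        using inj_on_cycle_vertex[OF assms, of 0] \<open>k \<in> _\<close> \<open>l \<in> _\<close> by (auto dest: inj_onD)
    qed
    moreover have "p ` {0..<e} \<subseteq> {0..<e}" by (auto simp: p_def)
    ultimately show "bij_betw p {0..<e} {0..<e}"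
      by (simp add: bij_betw_def endo_inj_surj)
  qed (simp add: p_def)
  moreover have "cascade_matrix e \<in> carrier_mat e e" by (simp add: cascade_matrix_def)
  ultimately have "cascade_poly e = det (mat e e (\<lambda>(i, j). cascade_matrix e $$ (p i, p j)))"
    by (simp add: cascade_poly_def det_permute_rows_cols)
  also have "mat e e (\<lambda>(i, j). cascade_matrix e $$ (p i, p j)) =
      cascade_cycle_mat e (\<lambda>k. yvar (cycle_vertex e k))"
  proof (rule eq_matI)
    fix i j assume "i < dim_row (cascade_cycle_mat e (\<lambda>k. yvar (cycle_vertex e k)))"
      "j < dim_col (cascade_cycle_mat e (\<lambda>k. yvar (cycle_vertex e k)))"
    then have ij: "i < e" "j < e" by (simp_all add: cascade_cycle_mat_def)
    then have "p i < e" "p j < e" by (simp_all add: p_def)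
    then have "cascade_matrix e $$ (p i, p j) = cascade_entry e (p i + 1) (p j + 1)"
      by (simp add: cascade_matrix_def)
    then show "mat e e (\<lambda>(i, j). cascade_matrix e $$ (p i, p j)) $$ (i, j) =
        cascade_cycle_mat e (\<lambda>k. yvar (cycle_vertex e k)) $$ (i, j)"
      using ij by (simp add: Suc_p cascade_entry_cycle_vertex[OF assms] cascade_cycle_mat_def
          del: One_nat_def)
  qed (simp_all add: cascade_cycle_mat_def)
  finally show ?thesis .
qed

section \<open>Coefficients\<close>

lemma lookup_squarefree_exponent:
  assumes "finite U"
  shows "Poly_Mapping.lookup (squarefree_exponent U) i = of_bool (i \<in> U)"
  using assms by (simp add: squarefree_exponent_def lookup_sum lookup_single when_def)

lemma squarefree_exponent_eq_iff:
  assumes "finite U" "finite V"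
  shows "squarefree_exponent U = squarefree_exponent V \<longleftrightarrow> U = V"
proof
  assume eq: "squarefree_exponent U = squarefree_exponent V"
  have "i \<in> U \<longleftrightarrow> i \<in> V" for i
    by (metis assms eq lookup_squarefree_exponent of_bool_eq_iff)
  then show "U = V" by blast
qed simp

lemma monomial_degree_squarefree_exponent:
  assumes "finite U"
  shows "monomial_degree (squarefree_exponent U) = card U"
proof -
  have "Poly_Mapping.keys (squarefree_exponent U) = U"
    using assms by (auto simp: in_keys_iff lookup_squarefree_exponent)
  then show ?thesis
    using assms by (simp add: monomial_degree_def lookup_squarefree_exponent)
qed

lemma prod_yvar:
  assumes "finite U"
  shows "(\<Prod>i\<in>U. yvar i) = Poly_Mapping.single (squarefree_exponent U) 1"
  using assms
  by (induction U rule: finite_induct)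
     (simp_all add: squarefree_exponent_def yvar_def mult_single)

lemma lookup_sum_squarefree:
  assumes "finite F" "\<And>U. U \<in> F \<Longrightarrow> finite U"
  shows "Poly_Mapping.lookup (\<Sum>U\<in>F. Poly_Mapping.single (squarefree_exponent U) (1 :: int)) m =
    of_bool (m \<in> squarefree_exponent ` F)"
proof (cases "m \<in> squarefree_exponent ` F")
  case True
  then obtain V where V: "V \<in> F" "m = squarefree_exponent V" by auto
  have "Poly_Mapping.lookup (\<Sum>U\<in>F. Poly_Mapping.single (squarefree_exponent U) (1 :: int)) m =
      (\<Sum>U\<in>F. if U = V then 1 else 0)"
    unfolding lookup_sum
    by (rule sum.cong) (use assms V in \<open>auto simp: lookup_single squarefree_exponent_eq_iff when_def\<close>)
  then show ?thesis using assms V by simp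
next
  case False
  then show ?thesis
    by (auto simp: lookup_sum lookup_single when_def intro!: sum.neutral)
qed

lemma prod_one_plus_yvar:
  assumes "finite X"
  shows "(\<Prod>i\<in>X. 1 + yvar i) = (\<Sum>U\<in>Pow X. Poly_Mapping.single (squarefree_exponent U) 1)"
proof -
  have "(\<Prod>i\<in>X. yvar i + 1) = (\<Sum>U\<in>Pow X. (\<Prod>i\<in>U. yvar i))"
    by (simp add: prod_add[OF assms])
  also have "\<dots> = (\<Sum>U\<in>Pow X. Poly_Mapping.single (squarefree_exponent U) 1)"
    by (rule sum.cong) (use assms in \<open>auto intro: prod_yvar finite_subset\<close>)
  finally show ?thesis by (simp add: add.commute)
qed

lemma lookup_prod_one_plus_yvar:
  assumes "finite X"
  shows "Poly_Mapping.lookup (\<Prod>i\<in>X. 1 + yvar i) m = of_bool (m \<in> squarefree_exponent ` Pow X)"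
  unfolding prod_one_plus_yvar[OF assms]
  by (rule lookup_sum_squarefree) (use assms finite_subset in auto)

text \<open>As \<open>j\<close> is not in \<open>X\<close>, the map \<open>insert j\<close> is
  injective on \<open>Pow X\<close>; the product thus expands into distinct squarefree monomials
  with coefficient 1.\<close>

lemma lookup_yvar_mult_prod:
  assumes "finite X" "j \<notin> X"
  shows "Poly_Mapping.lookup (yvar j * (\<Prod>i\<in>X. 1 + yvar i)) m =
    of_bool (m \<in> squarefree_exponent ` insert j ` Pow X)"
proof -
  have "yvar j * (\<Prod>i\<in>X. 1 + yvar i) =
      (\<Sum>U\<in>Pow X. Poly_Mapping.single (squarefree_exponent (insert j U)) 1)"
    unfolding prod_one_plus_yvar[OF assms(1)] sum_distrib_left
  proof (rule sum.cong)
    fix U assume "U \<in> Pow X"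
    then have "finite U" "j \<notin> U" using assms finite_subset by auto
    then show "yvar j * Poly_Mapping.single (squarefree_exponent U) 1 =
        Poly_Mapping.single (squarefree_exponent (insert j U)) 1"
      by (simp add: yvar_def mult_single squarefree_exponent_def)
  qed simp
  also have "\<dots> = (\<Sum>U\<in>insert j ` Pow X. Poly_Mapping.single (squarefree_exponent U) 1)"
    by (subst sum.reindex) (use assms in \<open>auto intro!: inj_onI simp: insert_ident\<close>)
  finally show ?thesis
    using assms finite_subset by (simp only:) (rule lookup_sum_squarefree; auto)
qed

lemma lookup_minus_one_power_mult:
  fixes q :: int_mpoly
  shows "Poly_Mapping.lookup ((- 1) ^ t * q) m = (- 1) ^ t * Poly_Mapping.lookup q m"
  by (cases "even t") simp_all

section \<open>Reading coefficients off the doubled determinant identity\<close>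

definition cycle_arc :: "nat \<Rightarrow> nat \<Rightarrow> nat \<Rightarrow> nat set" where
  "cycle_arc e k t = (\<lambda>s. cycle_vertex e (k + Suc s)) ` {..<t}"

lemma lookup_cascade_poly:
  assumes "odd e" "e \<ge> 3"
  shows "2 * Poly_Mapping.lookup (cascade_poly e) m =
    (\<Sum>k<e. \<Sum>t<e. (- 1) ^ t *
       of_bool (m \<in> squarefree_exponent ` insert (cycle_vertex e k) ` Pow (cycle_arc e k t))) -
    (of_bool (m = 0) + of_bool (m \<in> squarefree_exponent ` Pow {1..e}))"
proof -
  let ?z = "\<lambda>k. yvar (cycle_vertex e k)"
  have full: "(\<Prod>k<e. 1 + ?z k) = (\<Prod>i\<in>{1..e}. 1 + yvar i)"
    using prod.reindex[OF inj_on_cycle_vertex[OF assms(1), of 0], of "\<lambda>i. 1 + yvar i"]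
    by (simp add: cycle_vertex_image[OF assms(1), of 0, simplified] o_def)
  have arc: "(\<Prod>s<t. 1 + ?z (k + Suc s)) = (\<Prod>i\<in>cycle_arc e k t. 1 + yvar i)"
    and notin: "cycle_vertex e k \<notin> cycle_arc e k t" if "t < e" for k t
  proof -
    have "inj_on (\<lambda>s. cycle_vertex e (Suc k + s)) {..<t}"
      using inj_on_cycle_vertex[OF assms(1)] by (rule inj_on_subset) (use that in auto)
    then show "(\<Prod>s<t. 1 + ?z (k + Suc s)) = (\<Prod>i\<in>cycle_arc e k t. 1 + yvar i)"
      unfolding cycle_arc_def by (subst prod.reindex) simp_all
    have "cycle_vertex e (k + 0) \<noteq> cycle_vertex e (k + Suc s)" if "s < t" for s
      using inj_onD[OF inj_on_cycle_vertex[OF assms(1), of k], of 0 "Suc s"] \<open>t < e\<close> that by auto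
    then show "cycle_vertex e k \<notin> cycle_arc e k t"
      by (auto simp: cycle_arc_def)
  qed
  have fin: "finite (cycle_arc e k t)" for k t by (simp add: cycle_arc_def)
  have zero: "squarefree_exponent {} = 0" by (simp add: squarefree_exponent_def)
  have zero_in: "0 \<in> squarefree_exponent ` Pow {1..e}"
    by (rule image_eqI[of _ _ "{}"]) (simp_all add: zero)
  \<comment> \<open>A nonzero constant term is enough to supply the assumption \<open>nz\<close> of
    the determinant formula.\<close>
  have "Poly_Mapping.lookup (1 + (\<Prod>k<e. 1 + ?z k)) 0 = 2"
    unfolding full lookup_add
    by (subst lookup_prod_one_plus_yvar) (use zero_in in simp_all)
  then have nz: "1 + (\<Prod>k<e. 1 + ?z k) \<noteq> 0" by auto
  have "2 * cascade_poly e =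
      (\<Sum>k<e. ?z k * (\<Sum>t<e. (- 1) ^ t * (\<Prod>s<t. 1 + ?z (k + Suc s)))) - (1 + (\<Prod>k<e. 1 + ?z k))"
    unfolding cascade_poly_eq_det_cycle[OF assms(1)]
    by (rule det_cascade_cycle_mat) (use assms nz in auto)
  also have "\<dots> = (\<Sum>k<e. \<Sum>t<e. (- 1) ^ t * (?z k * (\<Prod>i\<in>cycle_arc e k t. 1 + yvar i))) -
      (1 + (\<Prod>i\<in>{1..e}. 1 + yvar i))"
  proof -
    have "(\<Sum>t<e. (- 1) ^ t * (\<Prod>s<t. 1 + ?z (k + Suc s))) =
        (\<Sum>t<e. (- 1) ^ t * (\<Prod>i\<in>cycle_arc e k t. 1 + yvar i))" for k
      by (rule sum.cong[OF refl]) (simp only: arc lessThan_iff)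
    then show ?thesis
      unfolding full by (simp only: sum_distrib_left mult.left_commute)
  qed
  finally have eq: "cascade_poly e + cascade_poly e = \<dots>" by (simp only: mult_2)
  have "2 * Poly_Mapping.lookup (cascade_poly e) m =
      Poly_Mapping.lookup (cascade_poly e + cascade_poly e) m"
    by (simp only: lookup_add mult_2)
  also have "\<dots> = (\<Sum>k<e. \<Sum>t<e. (- 1) ^ t *
       Poly_Mapping.lookup (?z k * (\<Prod>i\<in>cycle_arc e k t. 1 + yvar i)) m) -
    (Poly_Mapping.lookup 1 m + Poly_Mapping.lookup (\<Prod>i\<in>{1..e}. 1 + yvar i) m)"
    unfolding eq by (simp only: lookup_add lookup_minus lookup_sum lookup_minus_one_power_mult)
  also have "(\<Sum>k<e. \<Sum>t<e. (- 1) ^ t *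
       Poly_Mapping.lookup (?z k * (\<Prod>i\<in>cycle_arc e k t. 1 + yvar i)) m) =
    (\<Sum>k<e. \<Sum>t<e. (- 1) ^ t *
       of_bool (m \<in> squarefree_exponent ` insert (cycle_vertex e k) ` Pow (cycle_arc e k t)))"
    by (intro sum.cong refl) (simp only: lookup_yvar_mult_prod[OF fin notin] lessThan_iff)
  also have "Poly_Mapping.lookup 1 m = of_bool (m = 0)"
    by (simp add: lookup_one when_def)
  also have "Poly_Mapping.lookup (\<Prod>i\<in>{1..e}. 1 + yvar i) m = of_bool (m \<in> squarefree_exponent ` Pow {1..e})"
    by (rule lookup_prod_one_plus_yvar) simp
  finally show ?thesis .
qed

text \<open>Every monomial in the formula for the doubled polynomial is squarefree with variables
  from \<open>{1..e}\<close>, and doubling is injective on the integers.\<close>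

lemma lookup_cascade_poly_not_squarefree:
  assumes "odd e" "e \<ge> 3" "m \<notin> squarefree_exponent ` Pow {1..e}"
  shows "Poly_Mapping.lookup (cascade_poly e) m = 0"
proof -
  have "cycle_vertex e k \<in> {1..e}" for k
    using assms by (auto simp: cycle_vertex_def less_eq_Suc_le[symmetric])
  then have "m \<notin> squarefree_exponent ` insert (cycle_vertex e k) ` Pow (cycle_arc e k t)" for k t
    using assms(3) by (fastforce simp: cycle_arc_def)
  moreover have "m \<noteq> 0"
  proof
    assume "m = 0"
    then have "m = squarefree_exponent {}" by (simp add: squarefree_exponent_def)
    then show False using assms(3) by blast
  qed
  ultimately show ?thesis
    using lookup_cascade_poly[OF assms(1,2), of m] assms(3) by simp
qed

text \<open>Only pairs \<open>k\<close>, \<open>t\<close> whose starting vertex lies in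
  \<open>S\<close> and whose arc covers the rest of \<open>S\<close> contribute. Of the two
  subtracted terms, the full product always contributes 1 and the constant only for empty
  \<open>S\<close>.\<close>

lemma lookup_cascade_poly_squarefree:
  assumes "odd e" "e \<ge> 3" and S: "S \<subseteq> {1..e}"
  shows "2 * Poly_Mapping.lookup (cascade_poly e) (squarefree_exponent S) =
    (\<Sum>k | k < e \<and> cycle_vertex e k \<in> S.
       \<Sum>t | t < e \<and> S \<subseteq> insert (cycle_vertex e k) (cycle_arc e k t). (- 1) ^ t) -
    (of_bool (S = {}) + 1)"
proof -
  have fin: "finite S" using S finite_subset by blast
  have fin': "finite (cycle_arc e k t)" for k t by (simp add: cycle_arc_def)
  have ex: "squarefree_exponent S \<in> squarefree_exponent ` F \<longleftrightarrow> S \<in> F" if "\<And>U. U \<in> F \<Longrightarrow> finite U" for F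
    using that fin by (auto simp: squarefree_exponent_eq_iff)
  have "squarefree_exponent S \<in> squarefree_exponent ` insert j ` Pow X \<longleftrightarrow> j \<in> S \<and> S \<subseteq> insert j X"
    if "finite X" for j X
  proof -
    have "squarefree_exponent S \<in> squarefree_exponent ` insert j ` Pow X \<longleftrightarrow> S \<in> insert j ` Pow X"
      by (rule ex) (use that finite_subset in auto)
    also have "\<dots> \<longleftrightarrow> j \<in> S \<and> S \<subseteq> insert j X"
    proof
      assume "j \<in> S \<and> S \<subseteq> insert j X"
      then have "S = insert j (S - {j})" "S - {j} \<in> Pow X" by auto
      then show "S \<in> insert j ` Pow X" by (rule image_eqI)
    qed auto
    finally show ?thesis .
  qed
  note mem = this[OF fin']
  have "squarefree_exponent S = 0 \<longleftrightarrow> S = {}"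
    using squarefree_exponent_eq_iff[OF fin, of "{}"] by (simp add: squarefree_exponent_def)
  moreover have "squarefree_exponent S \<in> squarefree_exponent ` Pow {1..e}"
    using S by blast
  moreover have "(\<Sum>k<e. \<Sum>t<e. (- 1) ^ t * of_bool (cycle_vertex e k \<in> S \<and> S \<subseteq> insert (cycle_vertex e k) (cycle_arc e k t))) =
      (\<Sum>k | k < e \<and> cycle_vertex e k \<in> S.
       \<Sum>t | t < e \<and> S \<subseteq> insert (cycle_vertex e k) (cycle_arc e k t). (- 1 :: int) ^ t)"
    by (intro sum.mono_neutral_cong_right) (auto intro!: sum.mono_neutral_cong_right)
  ultimately show ?thesis
    using lookup_cascade_poly[OF assms(1,2), of "squarefree_exponent S"]
    by (simp add: mem)
qed

section \<open>Components of induced subgraphs of the cycle\<close>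

text \<open>Symmetry makes connected induced subgraphs strongly connected, which gives access to
  reachability. What has to be reconciled is maximality among all subgraphs with maximality of the
  vertex set among induced ones.\<close>

lemma (in sym_digraph) connected_components_eq_sccs: "connected_components G = sccs"
proof -
  have sc: "strongly_connected H" if "induced_subgraph H G" "Digraph_Component.connected H" for H
  proof -
    have "wf_digraph H" using that(1) by (auto simp: induced_subgraph_def subgraph_def)
    then show ?thesis
      using induced_graph_imp_symmetric[OF sym_arcs that(1)] that(2)
      by (rule wf_digraph.symmetric_connected_imp_strongly_connected)
  qed
  have conn: "Digraph_Component.connected H" if "strongly_connected H" for H :: "('a, 'b) pre_digraph"
    unfolding connected_conv
  proof (intro conjI ballI)
    fix u v assume "u \<in> verts H" "v \<in> verts H"
    then have "(u, v) \<in> rtrancl_on (verts H) (arcs_ends H)"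
      using that by (auto simp: strongly_connected_def reachable_def)
    then show "(u, v) \<in> rtrancl_on (verts H) ((arcs_ends H)\<^sup>s)"
      by (rule rtrancl_on_mono[rotated 2]) (auto simp: symcl_def)
  qed (use that in \<open>auto simp: strongly_connected_def\<close>)
  \<comment> \<open>Extra arcs on the same vertices preserve connectedness, so a maximal connected
    subgraph is induced.\<close>
  have mono: "arc_mono Digraph_Component.connected"
    unfolding arc_mono_def
    by (metis spanning_def subgraphE wf_digraph.connected_spanning_imp_connected)
  have "H \<in> sccs" if H: "max_subgraph Digraph_Component.connected H" for H
  proof -
    have "strongly_connected H"
      using induced_subgraphI_arc_mono[OF H mono] max_subgraph_prop[OF H] by (rule sc)
    then show ?thesis
      using max_subgraph_mp[OF H conn] by (simp add: sccs_altdef2)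
  qed
  moreover have "max_subgraph Digraph_Component.connected H" if H: "H \<in> sccs" for H
  proof (rule max_subgraphI)
    show "Digraph_Component.connected H" using H conn by (auto simp: sccs_def)
    show "subgraph H G" using H by (auto simp: sccs_def)
    fix K assume K: "H \<noteq> K" "subgraph H K" "subgraph K G"
    show "\<not> Digraph_Component.connected K"
    proof
      assume "Digraph_Component.connected K"
      \<comment> \<open>\<open>K\<close> itself may fail to be induced; its induced closure can be
        compared with \<open>H\<close> by the maximality of \<open>H\<close>.\<close>
      moreover have "subgraph K (G \<restriction> verts K)"
        using K(3) by (rule subgraph_induce_subgraphI2)
      ultimately have "Digraph_Component.connected (G \<restriction> verts K)"
        using mono unfolding arc_mono_def by (metis induce_subgraph_verts)
      moreover have ind: "induced_subgraph (G \<restriction> verts K) G"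
        using K(3) by (intro induced_induce) (auto simp: subgraph_def)
      ultimately have "strongly_connected (G \<restriction> verts K)" by (intro sc)
      then have "\<not> verts H \<subset> verts K"
        using H ind unfolding sccs_def by (metis (mono_tags, lifting) induce_subgraph_verts mem_Collect_eq)
      then have "verts K = verts H" using K(2) by (auto simp: subgraph_def psubset_eq)
      \<comment> \<open>Being induced, \<open>H\<close> is already the largest subgraph on its
        vertices, so a different \<open>K\<close> above it needs more vertices.\<close>
      moreover have "max_subgraph (\<lambda>H'. verts H' = verts H) H"
        using H by (simp add: sccs_def flip: induced_subgraph_altdef2)
      then have "\<forall>H'. H' \<noteq> H \<and> subgraph H H' \<longrightarrow> \<not> (subgraph H' G \<and> verts H' = verts H)"
        by (simp add: max_subgraph_def)
      from this[rule_format, of K] have "\<not> (subgraph K G \<and> verts K = verts H)"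
        using K(1,2) by simp
      ultimately show False
        using K(3) by simp
    qed
  qed
  ultimately show ?thesis by (auto simp: connected_components_def)
qed

text \<open>Here \<open>f\<close> is a complete invariant of reachability, so the components are its
  fibres, and distinct components have distinct vertex sets.\<close>

lemma (in sym_digraph) sum_connected_components:
  assumes reach: "\<And>u v. u \<in> verts G \<Longrightarrow> v \<in> verts G \<Longrightarrow> u \<rightarrow>\<^sup>* v \<longleftrightarrow> f u = f v"
  shows "(\<Sum>H\<in>connected_components G. h (verts H)) = (\<Sum>k\<in>f ` verts G. h {v \<in> verts G. f v = k})"
proof -
  have scc: "scc_of u = {v \<in> verts G. f v = f u}" if "u \<in> verts G" for u
  proof (rule Set.set_eqI)
    fix v
    show "v \<in> scc_of u \<longleftrightarrow> v \<in> {v \<in> verts G. f v = f u}"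
    proof (cases "v \<in> verts G")
      case True
      then show ?thesis
        unfolding scc_of_def mem_Collect_eq reach[OF that True] reach[OF True that] by auto
    next
      case False
      then have "\<not> u \<rightarrow>\<^sup>* v" by (meson reachable_in_verts)
      then show ?thesis using False by (simp add: scc_of_def)
    qed
  qed
  have "(\<Sum>H\<in>connected_components G. h (verts H)) = (\<Sum>V\<in>verts ` sccs. h V)"
    by (simp add: connected_components_eq_sccs sum.reindex[OF inj_on_verts_sccs])
  also have "verts ` sccs = scc_of ` verts G"
    by (simp flip: sccs_verts_conv add: sccs_verts_conv_scc_of)
  also have "\<dots> = (\<lambda>k. {v \<in> verts G. f v = k}) ` f ` verts G"
    by (auto simp: scc image_image)
  also have "(\<Sum>V\<in>\<dots>. h V) = (\<Sum>k\<in>f ` verts G. h {v \<in> verts G. f v = k})"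
    by (subst sum.reindex) (auto intro!: inj_onI)
  finally show ?thesis .
qed

section \<open>The successor map on \<open>1..e\<close>, first hits, and reachability in the
  complement of a set\<close>

definition cycle_succ :: "nat \<Rightarrow> nat \<Rightarrow> nat" where
  "cycle_succ e i = (i - 1 + e div 2) mod e + 1"

lemma cycle_succ_vertex [simp]: "cycle_succ e (cycle_vertex e k) = cycle_vertex e (Suc k)"
  by (simp add: cycle_succ_def cycle_vertex_def mod_simps add.commute)

lemma cycle_succ_iter_vertex [simp]: "(cycle_succ e ^^ t) (cycle_vertex e k) = cycle_vertex e (k + t)"
  by (induction t) simp_all

lemma cycle_vertex_cases:
  assumes "odd e" "i \<in> {1..e}"
  obtains s where "s < e" "i = cycle_vertex e (k + s)"
  using assms cycle_vertex_image[OF assms(1), of k] by (metis (no_types, lifting) imageE lessThan_iff)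

lemma cycle_vertex_in:
  assumes "odd e"
  shows "cycle_vertex e k \<in> {1..e}"
proof -
  have "e > 0" using assms by (cases e) auto
  then show ?thesis by (simp add: cycle_vertex_def less_eq_Suc_le[symmetric])
qed

lemma cycle_succ_in:
  assumes "odd e" "i \<in> {1..e}"
  shows "cycle_succ e i \<in> {1..e}"
  by (rule cycle_vertex_cases[OF assms, of 0]) (simp add: cycle_vertex_in[OF assms(1), simplified])

lemma cycle_succ_inj:
  assumes "odd e" "i \<in> {1..e}" "j \<in> {1..e}" "cycle_succ e i = cycle_succ e j"
  shows "i = j"
proof -
  obtain k l where "i = cycle_vertex e (0 + k)" "j = cycle_vertex e (0 + l)"
    using cycle_vertex_cases[OF assms(1,2), of 0] cycle_vertex_cases[OF assms(1,3), of 0] by metis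
  then show ?thesis
    using assms(1,4) cong_add_rcancel_nat[of k 1 l e] by (simp add: cycle_vertex_eq_iff)
qed

lemma cycle_succ_eq_iff:
  assumes "i \<in> {1..e}" "j \<in> {1..e}"
  shows "j = cycle_succ e i \<longleftrightarrow> [j = i + e div 2] (mod e)"
proof -
  have "[j = i + e div 2] (mod e) \<longleftrightarrow> [(j - 1) + 1 = (i - 1 + e div 2) + 1] (mod e)"
    using assms by simp
  also have "\<dots> \<longleftrightarrow> [j - 1 = i - 1 + e div 2] (mod e)"
    by (rule cong_add_rcancel_nat)
  also have "\<dots> \<longleftrightarrow> j - 1 = (i - 1 + e div 2) mod e"
    using assms by (auto simp: cong_def)
  finally show ?thesis
    using assms by (auto simp: cycle_succ_def)
qed

lemma cascade_subgraph_simps: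
  assumes "C \<subseteq> {1..e}"
  shows "verts (cascade_graph e \<restriction> C) = C"
    and "arcs_ends (cascade_graph e \<restriction> C) =
      {(i, j). i \<in> C \<and> j \<in> C \<and> (j = cycle_succ e i \<or> i = cycle_succ e j)}"
proof -
  show "verts (cascade_graph e \<restriction> C) = C"
    by simp
  have "arcs_ends (cascade_graph e \<restriction> C) =
      {(i, j). i \<in> {1..e} \<and> j \<in> {1..e} \<and> i \<in> C \<and> j \<in> C \<and>
        ([j = i + e div 2] (mod e) \<or> [i = j + e div 2] (mod e))}"
    by (auto simp: cascade_graph_def arcs_ends_conv)
  also have "\<dots> = {(i, j). i \<in> C \<and> j \<in> C \<and> (j = cycle_succ e i \<or> i = cycle_succ e j)}"
  proof -
    have "i \<in> {1..e} \<and> j \<in> {1..e} \<and> i \<in> C \<and> j \<in> C \<and>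
        ([j = i + e div 2] (mod e) \<or> [i = j + e div 2] (mod e)) \<longleftrightarrow>
      i \<in> C \<and> j \<in> C \<and> (j = cycle_succ e i \<or> i = cycle_succ e j)" for i j
      using assms cycle_succ_eq_iff[of i e j] cycle_succ_eq_iff[of j e i] by blast
    then show ?thesis by simp
  qed
  finally show "arcs_ends (cascade_graph e \<restriction> C) =
      {(i, j). i \<in> C \<and> j \<in> C \<and> (j = cycle_succ e i \<or> i = cycle_succ e j)}" .
qed

lemma sym_digraph_cascade_subgraph:
  assumes "C \<subseteq> {1..e}"
  shows "sym_digraph (cascade_graph e \<restriction> C)"
proof
  show "tail (cascade_graph e \<restriction> C) a \<in> verts (cascade_graph e \<restriction> C)"
    "head (cascade_graph e \<restriction> C) a \<in> verts (cascade_graph e \<restriction> C)"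
    if "a \<in> arcs (cascade_graph e \<restriction> C)" for a
    using that by auto
  show "symmetric (cascade_graph e \<restriction> C)"
    by (auto simp: symmetric_def cascade_subgraph_simps[OF assms] intro: symI)
qed

text \<open>Only meaningful if the orbit of \<open>i\<close> under \<open>s\<close> meets \<open>T\<close>.\<close>

definition first_hit :: "('a \<Rightarrow> 'a) \<Rightarrow> 'a set \<Rightarrow> 'a \<Rightarrow> 'a" where
  "first_hit s T i = (s ^^ (LEAST t. (s ^^ t) i \<in> T)) i"

text \<open>The hitting time of \<open>i\<close> is finite and not 0, hence one more than that of
  \<open>s i\<close>.\<close>

lemma first_hit_step:
  assumes "i \<notin> T" "(s ^^ t) i \<in> T"
  shows "first_hit s T i = first_hit s T (s i)"
proof -
  have "(LEAST t. (s ^^ t) i \<in> T) = Suc (LEAST t. (s ^^ Suc t) i \<in> T)"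
    by (rule Least_Suc[of _ t]) (use assms in auto)
  then show ?thesis
    unfolding first_hit_def by (simp add: funpow_swap1)
qed

lemma first_hit_in: "i \<in> T \<Longrightarrow> first_hit s T i = i"
  by (simp add: first_hit_def Least_eq_0)

text \<open>The successor map is a single cycle on \<open>{1..e}\<close>, so every orbit meets
  \<open>T\<close>.\<close>

lemma cycle_succ_reaches:
  assumes "odd e" "T \<subseteq> {1..e}" "T \<noteq> {}" "i \<in> {1..e}"
  obtains t where "(cycle_succ e ^^ t) i \<in> T"
proof -
  obtain k where "i = cycle_vertex e (0 + k)" using cycle_vertex_cases[OF assms(1,4)] .
  moreover obtain j where j: "j \<in> T" using assms(3) by auto
  moreover obtain t where "j = cycle_vertex e (k + t)"
    using cycle_vertex_cases[OF assms(1), of j k] j assms(2) by blast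
  ultimately show ?thesis by (intro that[of t]) simp
qed

lemma first_hit_mem:
  assumes "odd e" "T \<subseteq> {1..e}" "T \<noteq> {}" "i \<in> {1..e}"
  shows "first_hit (cycle_succ e) T i \<in> T"
proof -
  obtain t where "(cycle_succ e ^^ t) i \<in> T" using cycle_succ_reaches[OF assms] .
  then show ?thesis unfolding first_hit_def by (rule LeastI)
qed

text \<open>An edge inside the complement does not change the first hit. Conversely, each vertex is
  joined to the last vertex of its block, which the first hit determines as its predecessor.\<close>

lemma cascade_subgraph_reachable_iff:
  assumes "odd e" and T: "T \<subseteq> {1..e}" "T \<noteq> {}" and uv: "u \<in> {1..e} - T" "v \<in> {1..e} - T"
  shows "u \<rightarrow>\<^sup>*\<^bsub>cascade_graph e \<restriction> ({1..e} - T)\<^esub> v \<longleftrightarrow>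
    first_hit (cycle_succ e) T u = first_hit (cycle_succ e) T v"
proof -
  let ?C = "{1..e} - T" and ?s = "cycle_succ e" and ?f = "first_hit (cycle_succ e) T"
  let ?G = "cascade_graph e \<restriction> ?C"
  have sub: "?C \<subseteq> {1..e}" by auto
  interpret sym_digraph ?G by (rule sym_digraph_cascade_subgraph[OF sub])
  have hit_step: "?f i = ?f (?s i)" if i: "i \<in> ?C" for i
  proof -
    obtain t where "(?s ^^ t) i \<in> T" using cycle_succ_reaches[OF assms(1) T, of i] i by blast
    then show ?thesis using i by (intro first_hit_step) auto
  qed
  \<comment> \<open>The witness \<open>p\<close> is the last vertex before \<open>T\<close>; the
    induction follows the walk from \<open>i\<close> to it.\<close>
  have last: "\<exists>p\<in>?C. ?s p = ?f i \<and> i \<rightarrow>\<^sup>*\<^bsub>?G\<^esub> p" if "i \<in> ?C" "(?s ^^ t) i \<in> T" for i t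
    using that
  proof (induction t arbitrary: i)
    case (Suc t)
    have verts: "i \<in> verts ?G" using Suc.prems(1) by (simp only: cascade_subgraph_simps[OF sub])
    show ?case
    proof (cases "?s i \<in> T")
      case True
      then have "?s i = ?f i" using hit_step[OF Suc.prems(1)] by (simp add: first_hit_in)
      moreover have "i \<rightarrow>\<^sup>*\<^bsub>?G\<^esub> i" using verts by (rule reachable_refl)
      ultimately show ?thesis using Suc.prems(1) by blast
    next
      case False
      then have si: "?s i \<in> ?C" using cycle_succ_in[OF assms(1)] Suc.prems(1) by blast
      then obtain p where p: "p \<in> ?C" "?s p = ?f (?s i)" "?s i \<rightarrow>\<^sup>*\<^bsub>?G\<^esub> p"
        using Suc.IH[of "?s i"] Suc.prems(2) by (auto simp: funpow_swap1)
      have "i \<rightarrow>\<^bsub>?G\<^esub> ?s i"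
        unfolding cascade_subgraph_simps(2)[OF sub] using Suc.prems(1) si by blast
      then have "i \<rightarrow>\<^sup>*\<^bsub>?G\<^esub> p" using p(3) by (rule adj_reachable_trans)
      then show ?thesis using p(1,2) hit_step[OF Suc.prems(1)] by (metis (no_types))
    qed
  qed auto
  have reach_last: "\<exists>p\<in>?C. ?s p = ?f i \<and> i \<rightarrow>\<^sup>*\<^bsub>?G\<^esub> p" if i: "i \<in> ?C" for i
  proof -
    have "i \<in> {1..e}" using i by blast
    then obtain t where "(?s ^^ t) i \<in> T" using cycle_succ_reaches[OF assms(1) T] by metis
    with i show ?thesis by (rule last)
  qed
  show ?thesis
  proof
    assume "u \<rightarrow>\<^sup>*\<^bsub>?G\<^esub> v"
    then show "?f u = ?f v"
    proof (induction rule: reachable_induct)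
      case (step x y)
      have "x \<in> ?C \<and> y \<in> ?C \<and> (y = ?s x \<or> x = ?s y)"
        using step(2) unfolding cascade_subgraph_simps(2)[OF sub] by blast
      then show ?case using step(3) hit_step[of x] hit_step[of y] by metis
    qed simp
  next
    assume eq: "?f u = ?f v"
    obtain p where p: "p \<in> ?C" "?s p = ?f u" "u \<rightarrow>\<^sup>*\<^bsub>?G\<^esub> p"
      using reach_last[OF uv(1)] by blast
    obtain q where q: "q \<in> ?C" "?s q = ?f v" "v \<rightarrow>\<^sup>*\<^bsub>?G\<^esub> q"
      using reach_last[OF uv(2)] by blast
    \<comment> \<open>Both are predecessors of the common first hit.\<close>
    have "p = q" by (rule cycle_succ_inj[OF assms(1)]) (use p q eq in auto)
    then show "u \<rightarrow>\<^sup>*\<^bsub>?G\<^esub> v"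
      using p(3) symmetric_reachable'[OF q(3)] reachable_trans by blast
  qed
qed

text \<open>This covers the empty \<open>T\<close>, for which first hits are meaningless: the whole
  cycle is connected by walking along it.\<close>

lemma cascade_graph_reachable:
  assumes "odd e" "u \<in> {1..e}" "v \<in> {1..e}"
  shows "u \<rightarrow>\<^sup>*\<^bsub>cascade_graph e \<restriction> {1..e}\<^esub> v"
proof -
  let ?G = "cascade_graph e \<restriction> {1..e}"
  interpret sym_digraph ?G by (rule sym_digraph_cascade_subgraph) simp
  note simps = cascade_subgraph_simps[of "{1..e}" e, OF subset_refl]
  obtain k where k: "u = cycle_vertex e (0 + k)" using cycle_vertex_cases[OF assms(1,2)] .
  obtain t where t: "v = cycle_vertex e (k + t)" using cycle_vertex_cases[OF assms(1,3)] .
  have "u \<rightarrow>\<^sup>*\<^bsub>?G\<^esub> cycle_vertex e (k + t)"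
  proof (induction t)
    case 0
    have "u \<in> verts ?G" unfolding simps(1) by (rule assms)
    then have "u \<rightarrow>\<^sup>*\<^bsub>?G\<^esub> u" by (rule reachable_refl)
    then show ?case using k by simp
  next
    case (Suc t)
    have "cycle_vertex e (k + t) \<rightarrow>\<^bsub>?G\<^esub> cycle_vertex e (k + Suc t)"
      unfolding simps(2)
      using cycle_vertex_in[OF assms(1)] cycle_succ_vertex[of e "k + t", symmetric] by auto
    with Suc show ?case by (rule reachable_adj_trans)
  qed
  then show ?thesis using t by simp
qed

section \<open>The cascade polynomial\<close>

lemma upward_closed_eq_interval:
  fixes V :: "nat set"
  assumes "V \<subseteq> {..<n}" and up: "\<And>t t'. t \<in> V \<Longrightarrow> t \<le> t' \<Longrightarrow> t' < n \<Longrightarrow> t' \<in> V"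
  shows "V = {n - card V..<n}"
proof (cases "V = {}")
  case False
  define m where "m = (LEAST t. t \<in> V)"
  obtain t0 where "t0 \<in> V" using False by blast
  then have "m \<in> V" unfolding m_def by (rule LeastI)
  have "V = {m..<n}"
  proof (intro equalityI subsetI)
    fix t assume "t \<in> V"
    moreover from this have "m \<le> t" unfolding m_def by (rule Least_le)
    ultimately show "t \<in> {m..<n}" using assms(1) by auto
  next
    fix t assume "t \<in> {m..<n}"
    then show "t \<in> V" using up[OF \<open>m \<in> V\<close>] by simp
  qed
  moreover have "m < n" using \<open>m \<in> V\<close> assms(1) by auto
  ultimately show ?thesis by simp
qed simp

text \<open>For odd \<open>n\<close> the top term is +1, and the terms below it cancel in pairs from
  the top down.\<close>

lemma alternating_sum_top:
  assumes "odd n" "c \<le> n"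
  shows "(\<Sum>t\<in>{n - c..<n}. (- 1 :: int) ^ t) = of_bool (odd c)"
  using assms(2)
proof (induction c)
  case (Suc c)
  have "{n - Suc c..<n} = insert (n - Suc c) {n - c..<n}" using Suc.prems by auto
  moreover have "even (n - Suc c) \<longleftrightarrow> even c" using Suc.prems assms(1) by auto
  ultimately show ?case using Suc by auto
qed simp

text \<open>An arc of length \<open>t\<close> starting at \<open>k \<in> T\<close> covers \<open>T\<close> iff it reaches the block of
  non-elements preceding \<open>k\<close>, so only the last \<open>1 + |block|\<close> terms contribute.\<close>

lemma sum_covering_arcs:
  assumes "odd e" and T: "T \<subseteq> {1..e}" and k: "k < e" "cycle_vertex e k \<in> T"
  shows "(\<Sum>t | t < e \<and> T \<subseteq> insert (cycle_vertex e k) (cycle_arc e k t). (- 1 :: int) ^ t) =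
    of_bool (even (card {v \<in> {1..e} - T. first_hit (cycle_succ e) T v = cycle_vertex e k}))"
proof -
  let ?v = "cycle_vertex e"
  \<comment> \<open>\<open>D\<close> holds the offsets from \<open>k\<close> of the block that
    closes the cycle just before \<open>k\<close>; \<open>V\<close> holds the lengths of the
    covering arcs.\<close>
  define D where "D = {m \<in> {1..<e}. \<forall>m'. m \<le> m' \<and> m' < e \<longrightarrow> ?v (k + m') \<notin> T}"
  define V where "V = {t. t < e \<and> T \<subseteq> insert (?v k) (cycle_arc e k t)}"
  have e: "e > 0" using k by simp
  have inj: "m = m'" if "?v (k + m) = ?v (k + m')" "m < e" "m' < e" for m m'
    using inj_onD[OF inj_on_cycle_vertex[OF assms(1), of k], of m m'] that by auto
  have fibre: "{v \<in> {1..e} - T. first_hit (cycle_succ e) T v = ?v k} = (\<lambda>m. ?v (k + m)) ` D"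
  proof (intro equalityI subsetI)
    fix v assume v: "v \<in> {v \<in> {1..e} - T. first_hit (cycle_succ e) T v = ?v k}"
    then obtain m where m: "m < e" "v = ?v (k + m)"
      using cycle_vertex_cases[OF assms(1), of v k] by blast
    have m0: "m > 0" using v k(2) m(2) by (cases m) auto
    define d where "d = (LEAST t. (cycle_succ e ^^ t) v \<in> T)"
    have hit: "?v (k + m + d) = ?v k"
      using v by (simp add: first_hit_def d_def m(2))
    \<comment> \<open>After \<open>e - m\<close> steps the walk is back at \<open>k\<close>.
      Reaching \<open>k\<close> earlier would put it at a nonzero offset below \<open>e\<close>, so
      \<open>e - m\<close> is the hitting time and the offsets from \<open>m\<close> to
      \<open>e - 1\<close> avoid \<open>T\<close>.\<close>
    have "(cycle_succ e ^^ (e - m)) v \<in> T"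
      using m k(2) by (simp add: add.assoc)
    then have "d \<le> e - m" unfolding d_def by (rule Least_le)
    moreover have "\<not> m + d < e"
      using inj[of "m + d" 0] hit m0 e by (auto simp: add.assoc)
    ultimately have d: "d = e - m" using m(1) by linarith
    have "?v (k + m') \<notin> T" if "m \<le> m'" "m' < e" for m'
    proof -
      have "m' - m < d" using that d by linarith
      then have "(cycle_succ e ^^ (m' - m)) v \<notin> T" unfolding d_def by (rule not_less_Least)
      then show ?thesis using that by (simp add: m(2))
    qed
    then have "m \<in> D" using m m0 by (auto simp: D_def)
    then show "v \<in> (\<lambda>m. ?v (k + m)) ` D" using m(2) by auto
  next
    fix v assume "v \<in> (\<lambda>m. ?v (k + m)) ` D"
    then obtain m where m: "m \<in> D" "v = ?v (k + m)" by auto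
    have "(LEAST t. (cycle_succ e ^^ t) v \<in> T) = e - m"
    proof (rule Least_equality)
      show "(cycle_succ e ^^ (e - m)) v \<in> T"
        using m k(2) by (simp add: D_def add.assoc)
      show "e - m \<le> t" if "(cycle_succ e ^^ t) v \<in> T" for t
      proof (rule ccontr)
        assume "\<not> e - m \<le> t"
        then have "m \<le> m + t \<and> m + t < e" by linarith
        then have "?v (k + (m + t)) \<notin> T" using m(1) unfolding D_def by blast
        then show False using that by (simp add: m(2) add.assoc)
      qed
    qed
    then have "first_hit (cycle_succ e) T v = ?v k"
      using m by (simp add: first_hit_def D_def add.assoc)
    moreover have "v \<notin> T" using m by (auto simp: D_def)
    moreover have "v \<in> {1..e}" unfolding m(2) by (rule cycle_vertex_in[OF assms(1)])
    ultimately show "v \<in> {v \<in> {1..e} - T. first_hit (cycle_succ e) T v = ?v k}" by blast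
  qed
  have "inj_on (\<lambda>m. ?v (k + m)) D"
    by (rule inj_onI) (auto simp: D_def intro: inj)
  then have card_fibre: "card {v \<in> {1..e} - T. first_hit (cycle_succ e) T v = ?v k} = card D"
    unfolding fibre by (rule card_image)
  \<comment> \<open>An arc of length \<open>t\<close> occupies the offsets 1 to \<open>t\<close>, so
    it covers \<open>T\<close> when no larger offset meets \<open>T\<close>.\<close>
  have V_iff: "t \<in> V \<longleftrightarrow> t < e \<and> (\<forall>m'. t < m' \<and> m' < e \<longrightarrow> ?v (k + m') \<notin> T)" for t
  proof
    assume t: "t \<in> V"
    have "?v (k + m') \<notin> T" if m': "t < m'" "m' < e" for m'
    proof
      assume "?v (k + m') \<in> T"
      then consider "?v (k + m') = ?v (k + 0)" | s where "s < t" "?v (k + m') = ?v (k + Suc s)"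
        using t by (auto simp: V_def cycle_arc_def)
      then show False
      proof cases
        case 1
        then show False using inj[OF 1] m' by simp
      next
        case 2
        then show False using inj[OF 2(2)] m' by simp
      qed
    qed
    then show "t < e \<and> (\<forall>m'. t < m' \<and> m' < e \<longrightarrow> ?v (k + m') \<notin> T)"
      using t by (auto simp: V_def)
  next
    assume t: "t < e \<and> (\<forall>m'. t < m' \<and> m' < e \<longrightarrow> ?v (k + m') \<notin> T)"
    have "i \<in> insert (?v k) (cycle_arc e k t)" if i: "i \<in> T" for i
    proof -
      have "i \<in> {1..e}" using i T by blast
      then obtain m where m: "m < e" "i = ?v (k + m)"
        using cycle_vertex_cases[OF assms(1), of i k] by blast
      then have "m \<le> t" using t i by (meson not_le)
      then show ?thesis
        using m by (cases m) (auto simp: cycle_arc_def)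
    qed
    then show "t \<in> V" using t by (auto simp: V_def)
  qed
  \<comment> \<open>The arc of length \<open>e - 1\<close> always covers; a shorter one does when
    the offsets from \<open>t + 1\<close> on lie in the block. Hence \<open>V\<close> has one
    element more than \<open>D\<close>, which flips the parity.\<close>
  have "V = insert (e - 1) {t. Suc t \<in> D}"
  proof (rule Set.set_eqI)
    fix t show "t \<in> V \<longleftrightarrow> t \<in> insert (e - 1) {t. Suc t \<in> D}"
    proof (cases "t = e - 1")
      case True
      then show ?thesis using e by (auto simp: V_iff)
    next
      case False
      then show ?thesis by (auto simp: V_iff D_def Suc_le_eq)
    qed
  qed
  moreover have "D = Suc ` {t. Suc t \<in> D}"
    by (auto simp: D_def image_iff dest: gr0_implies_Suc) (metis Suc_le_D One_nat_def)
  then have "card D = card {t. Suc t \<in> D}" "finite {t. Suc t \<in> D}"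
    by (metis card_image inj_Suc) (auto intro: finite_subset[of _ "{..<e}"] simp: D_def)
  moreover have "e - 1 \<notin> {t. Suc t \<in> D}" using e by (auto simp: D_def)
  ultimately have cardV: "card V = Suc (card D)" by simp
  have "V = {e - card V..<e}"
  proof (rule upward_closed_eq_interval)
    show "V \<subseteq> {..<e}" by (auto simp: V_def)
    show "t' \<in> V" if "t \<in> V" "t \<le> t'" "t' < e" for t t'
      using that by (auto simp: V_iff)
  qed
  moreover have "card V \<le> e"
    using card_mono[of "{..<e}" V] by (auto simp: V_def)
  ultimately have "(\<Sum>t\<in>V. (- 1 :: int) ^ t) = of_bool (odd (card V))"
    using alternating_sum_top[OF assms(1)] by metis
  then show ?thesis
    unfolding card_fibre cardV by (simp add: V_def)
qed

text \<open>For nonempty \<open>S\<close>, let \<open>n k\<close> be the size of the block before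
  \<open>k\<close>. Twice the coefficient counts the even \<open>n k\<close> and subtracts 1; each
  parity bit is \<open>n k + 1\<close> minus twice the rounded-up half of \<open>n k\<close>, and
  the numbers \<open>n k + 1\<close> add up to \<open>e\<close>.\<close>

lemma lookup_cascade_poly_components:
  assumes e: "e = 2 * e' + 1" "e \<ge> 3" and S: "S \<subseteq> {1..e}"
  shows "Poly_Mapping.lookup (cascade_poly e) (squarefree_exponent S) =
    int e' - (\<Sum>H\<in>connected_components (cascade_graph e \<restriction> ({1..e} - S)). \<lceil>real (card (verts H)) / 2\<rceil>)"
    (is "?c = int e' - ?comps")
proof -
  have odd: "odd e" using e by simp
  have ceil: "\<lceil>real n / 2\<rceil> = (int n + 1) div 2" for n :: nat
    by linarith
  let ?C = "{1..e} - S" and ?f = "first_hit (cycle_succ e) S"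
  let ?G = "cascade_graph e \<restriction> ?C"
  have C: "?C \<subseteq> {1..e}" by blast
  interpret sym_digraph ?G by (rule sym_digraph_cascade_subgraph[OF C])
  have verts: "verts ?G = ?C" by (rule cascade_subgraph_simps[OF C])
  show ?thesis
  proof (cases "S = {}")
    case True
    \<comment> \<open>The whole cycle is one component, so a constant map serves as reachability
      invariant.\<close>
    have "?comps = (\<Sum>k\<in>(\<lambda>_. ()) ` verts ?G. \<lceil>real (card {v \<in> verts ?G. () = k}) / 2\<rceil>)"
      by (rule sum_connected_components) (use verts True cascade_graph_reachable[OF odd] in simp)
    also have "(\<lambda>_. ()) ` verts ?G = {()}"
      using verts True e by auto
    also have "(\<Sum>k\<in>{()}. \<lceil>real (card {v \<in> verts ?G. () = k}) / 2\<rceil>) = \<lceil>real (card (verts ?G)) / 2\<rceil>"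
    proof -
      have "{v \<in> verts ?G. () = k} = verts ?G" for k by auto
      then show ?thesis by (simp only: sum.insert sum.empty finite.emptyI empty_iff not_False_eq_True add_0_right)
    qed
    also have "\<dots> = int e' + 1"
      unfolding verts ceil True using e by simp
    finally have "?comps = int e' + 1" .
    \<comment> \<open>No arc starts in the empty set; only the two subtracted constants
      remain.\<close>
    moreover have "2 * ?c = - 2"
      using lookup_cascade_poly_squarefree[OF odd e(2) S] True by simp
    ultimately show ?thesis by linarith
  next
    case False
    define n where "n k = card {v \<in> ?C. ?f v = k}" for k
    have fin: "finite S" using S finite_subset by blast
    have f_in: "?f v \<in> S" if "v \<in> ?C" for v
      using first_hit_mem[OF odd S False] that by blast
    have "?comps = (\<Sum>k\<in>?f ` verts ?G. \<lceil>real (card {v \<in> verts ?G. ?f v = k}) / 2\<rceil>)"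
      by (rule sum_connected_components)
         (unfold verts, rule cascade_subgraph_reachable_iff[OF odd S False])
    also have "\<dots> = (\<Sum>k\<in>?f ` ?C. (int (n k) + 1) div 2)"
      by (simp only: verts n_def ceil)
    \<comment> \<open>Elements of \<open>S\<close> with no block before them have
      \<open>n k = 0\<close>, whose rounded-up half is 0, so they may be added to the index
      set.\<close>
    also have "\<dots> = (\<Sum>k\<in>S. (int (n k) + 1) div 2)"
    proof (rule sum.mono_neutral_left[OF fin])
      show "\<forall>k\<in>S - ?f ` ?C. (int (n k) + 1) div 2 = 0"
      proof
        fix k assume "k \<in> S - ?f ` ?C"
        then have "{v \<in> ?C. ?f v = k} = {}" by blast
        then show "(int (n k) + 1) div 2 = 0" unfolding n_def by simp
      qed
    qed (use f_in in blast)
    finally have comps: "?comps = (\<Sum>k\<in>S. (int (n k) + 1) div 2)" .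
    \<comment> \<open>The fibres of the first hit partition the complement.\<close>
    have "card ?C = card (\<Union>k\<in>S. {v \<in> ?C. ?f v = k})"
      by (rule arg_cong[of _ _ card]) (use f_in in blast)
    also have "\<dots> = (\<Sum>k\<in>S. n k)"
      unfolding n_def by (rule card_UN_disjoint) (use fin in auto)
    finally have "(\<Sum>k\<in>S. n k) = e - card S"
      using S by (simp add: card_Diff_subset[OF fin])
    moreover have "card S \<le> e" using card_mono[OF _ S] by simp
    ultimately have total: "(\<Sum>k\<in>S. int (n k) + 1) = int e"
      by (simp add: sum.distrib flip: of_nat_sum)
    have "2 * ?c = (\<Sum>k | k < e \<and> cycle_vertex e k \<in> S. of_bool (even (n (cycle_vertex e k)))) - 1"
      unfolding lookup_cascade_poly_squarefree[OF odd e(2) S] n_def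
      by (subst sum.cong[OF refl sum_covering_arcs[OF odd S]]) (use False in auto)
    also have "(\<Sum>k | k < e \<and> cycle_vertex e k \<in> S. of_bool (even (n (cycle_vertex e k)))) =
        (\<Sum>i\<in>S. of_bool (even (n i)) :: int)"
    proof (rule sum.reindex_bij_betw)
      have "inj_on (cycle_vertex e) {k. k < e \<and> cycle_vertex e k \<in> S}"
        using inj_on_cycle_vertex[OF odd, of 0] by (auto simp: inj_on_def)
      moreover have "cycle_vertex e ` {k. k < e \<and> cycle_vertex e k \<in> S} = S"
        using cycle_vertex_image[OF odd, of 0] S by (auto simp: image_iff)
      ultimately show "bij_betw (cycle_vertex e) {k. k < e \<and> cycle_vertex e k \<in> S} S"
        by (simp add: bij_betw_def)
    qed
    also have "\<dots> = (\<Sum>i\<in>S. int (n i) + 1 - 2 * ((int (n i) + 1) div 2))"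
    proof (rule sum.cong[OF refl])
      fix i
      have "int (n i) + 1 - 2 * ((int (n i) + 1) div 2) = (int (n i) + 1) mod 2"
        by (simp add: minus_mult_div_eq_mod)
      also have "\<dots> = of_bool (even (n i))"
        by (cases "even (n i)") (simp_all add: mod_2_eq_odd)
      finally show "of_bool (even (n i)) = int (n i) + 1 - 2 * ((int (n i) + 1) div 2)" by simp
    qed
    also have "\<dots> = int e - 2 * ?comps"
      unfolding comps by (simp only: sum_subtractf total sum_distrib_left)
    finally show ?thesis using e by linarith
  qed
qed

section \<open>Non-negativity, total degree and leading form\<close>

lemma lookup_cascade_poly_nonneg:
  assumes "odd e" "e \<ge> 3" "S \<subseteq> {1..e}" "S \<noteq> {}"
  shows "Poly_Mapping.lookup (cascade_poly e) (squarefree_exponent S) \<ge> 0"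
proof -
  have "(\<Sum>k | k < e \<and> cycle_vertex e k \<in> S.
      \<Sum>t | t < e \<and> S \<subseteq> insert (cycle_vertex e k) (cycle_arc e k t). (- 1 :: int) ^ t) \<ge> 0"
    by (rule sum_nonneg) (use sum_covering_arcs[OF assms(1,3)] in auto)
  \<comment> \<open>Twice the coefficient is at least -1, and the coefficient is an integer.\<close>
  then show ?thesis
    using lookup_cascade_poly_squarefree[OF assms(1-3)] assms(4) by simp
qed

theorem theorem6p1:
  fixes e e' :: nat
  assumes "e = 2 * e' + 1" and "e \<ge> 3"
  shows "(\<forall>S \<subseteq> {1..e}.
            Poly_Mapping.lookup (cascade_poly e) (squarefree_exponent S) =
              int e' - (\<Sum>H \<in> connected_components (cascade_graph e \<restriction> ({1..e} - S)).
                          \<lceil>real (card (verts H)) / 2\<rceil>) \<and>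
            (S \<noteq> {} \<longrightarrow> Poly_Mapping.lookup (cascade_poly e) (squarefree_exponent S) \<ge> 0)) \<and>
         total_degree (cascade_poly e) = e \<and>
         leading_form (cascade_poly e) = of_nat e' * (\<Prod>i\<in>{1..e}. yvar i)"
proof -
  have odd: "odd e" using assms by simp
  let ?P = "cascade_poly e" and ?top = "squarefree_exponent {1..e}"
  \<comment> \<open>Connectedness requires a vertex, so the empty graph has no components and the
    top coefficient is \<open>e'\<close> itself.\<close>
  have "connected_components (cascade_graph e \<restriction> {}) = {}"
  proof -
    have "H \<notin> connected_components (cascade_graph e \<restriction> {})" for H
      by (auto simp: connected_components_def pre_digraph.max_subgraph_def subgraph_def connected_conv)
    then show ?thesis by blast
  qed
  then have lookup_top: "Poly_Mapping.lookup ?P ?top = int e'"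
    using lookup_cascade_poly_components[OF assms, of "{1..e}"] by simp
  have keys: "\<exists>U\<subseteq>{1..e}. m = squarefree_exponent U" if "m \<in> Poly_Mapping.keys ?P" for m
    using that lookup_cascade_poly_not_squarefree[OF odd assms(2), of m] by (auto simp: in_keys_iff)
  \<comment> \<open>From \<open>e \<ge> 3\<close> it follows that \<open>e'\<close> is
    nonzero.\<close>
  have top_in: "?top \<in> Poly_Mapping.keys ?P"
    using lookup_top assms by (simp add: in_keys_iff)
  have deg: "monomial_degree (squarefree_exponent U) = card U" if "U \<subseteq> {1..e}" for U
    by (rule monomial_degree_squarefree_exponent) (rule finite_subset[OF that], simp)
  have total: "total_degree ?P = e"
    unfolding total_degree_def
  proof (rule Max_eqI)
    show "e \<in> insert 0 (monomial_degree ` Poly_Mapping.keys ?P)"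
      using deg[of "{1..e}"] top_in by (force simp: image_iff)
    show "d \<le> e" if d: "d \<in> insert 0 (monomial_degree ` Poly_Mapping.keys ?P)" for d
    proof (cases "d = 0")
      case False
      then obtain U where "U \<subseteq> {1..e}" "d = card U" using d keys deg by blast
      then show ?thesis using card_mono[of "{1..e}" U] by simp
    qed simp
  qed simp
  \<comment> \<open>All monomials are squarefree in \<open>e\<close> variables, so degree
    \<open>e\<close> forces the full set.\<close>
  have "{m \<in> Poly_Mapping.keys ?P. monomial_degree m = e} = {?top}"
  proof (intro equalityI subsetI)
    fix m assume m: "m \<in> {m \<in> Poly_Mapping.keys ?P. monomial_degree m = e}"
    then obtain U where U: "U \<subseteq> {1..e}" "m = squarefree_exponent U" using keys by blast
    then have "card U = card {1..e}" using m deg by simp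
    then have "U = {1..e}" using U by (intro card_subset_eq) auto
    then show "m \<in> {?top}" using U by simp
  qed (use top_in deg[of "{1..e}"] in simp)
  then have "leading_form ?P = Poly_Mapping.single ?top (int e')"
    by (simp add: leading_form_def total lookup_top[simplified])
  also have "\<dots> = of_nat e' * (\<Prod>i\<in>{1..e}. yvar i)"
    by (simp add: prod_yvar mult_single flip: single_of_nat)
  finally show ?thesis
    using lookup_cascade_poly_components[OF assms] lookup_cascade_poly_nonneg[OF odd assms(2)] total
    by blast
qed

end
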